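(* Let $\mathcal C\subseteq 2^{[n]}$ be a neural code. If $\mathcal C$ is convex, then $\mathcal C$ is locally perfect. In particular, if $\mathcal C$ has a convex realization in $\mathbb R^d$, then for all $\sigma\in\Delta(\mathcal C)\setminus\mathcal C$ the link $\operatorname{Lk}_{\Delta(\mathcal C)}(\sigma)$ is $d$-convex union representable.
   Context: A simplicial complex on a finite ground set is a collection $\Delta$ of subsets (faces) closed under inclusion; elements of the ground set need not be vertices. For a face $\sigma$, $\operatorname{Lk}_\Delta(\sigma)=\{\tau\in\Delta\mid\tau\cup\sigma\in\Delta,\ \tau\cap\sigma=\emptyset\}$. For a collection $\{U_i\}_{i\in I}$ ($I$ finite) of convex subsets of $\mathbb R^d$ (the empty set is convex and open), put $U_\sigma=\bigcap_{i\in\sigma}U_i$ for $\emptyset\ne\sigma\subseteq I$ and $U_\emptyset=\operatorname{conv}(\bigcup_{i\in I} U_i)$. The nerve is $\mathcal N(\{U_i\})=\{\sigma\subseteq I\mid U_\sigma\neq\emptyset\}$. A complex $\Delta$ on ground set $I$ is $d$-convex union representable if $\Delta=\mathcal N(\{U_i\}_{i\in I})$ for some convex open sets $U_i\subseteq\mathbb R^d$ whose union is convex; it is convex union representable if this holds for some integer $d\ge 0$. A neural code is a subset $\mathcal C\subseteq 2^{[n]}$, where $[n]=\{1,\dots,n\}$. Given convex open sets $\{U_i\}_{i=1}^n$ in $\mathbb R^d$, their code is $\operatorname{code}(\{U_i\})=\{\sigma\subseteq[n]\mid U_\sigma\setminus\bigcup_{j\notin\sigma}U_j\neq\emptyset\}$,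 where $U_\sigma=\bigcap_{i\in\sigma}U_i$ for $\sigma\neq\emptyset$ and $U_\emptyset=\operatorname{conv}(\bigcup_{i=1}^n U_i)$; $\{U_i\}$ is then called a convex realization of this code in $\mathbb R^d$. A code is convex if it has a convex realization in some $\mathbb R^d$. $\Delta(\mathcal C)$ denotes the smallest simplicial complex containing $\mathcal C$. $\mathcal C$ has a nerve obstruction at $\sigma\in\Delta(\mathcal C)\setminus\mathcal C$ if $\operatorname{Lk}_{\Delta(\mathcal C)}(\sigma)$ is not convex union representable; $\mathcal C$ is locally perfect if it has no nerve obstructions. *)

theory Defs
  imports "HOL-Analysis.Analysis" "HOL-Library.Function_Algebras"
begin

text \<open>
  The dimension \<open>d\<close> is quantified inside definitions, so \<open>d\<close>-dimensional real space is the library's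
  \<^const>\<open>Euclidean_space\<close> \<open>d\<close>: the functions \<open>x :: nat \<Rightarrow> real\<close> with \<open>x i = 0\<close> for \<open>i \<ge> d\<close>, with the
  topology induced by the product topology (a single point for \<open>d = 0\<close>). The pointwise vector space
  structure below makes \<^const>\<open>convex\<close> and convex hulls available on it; the carrier is a linear
  subspace, so convexity and hulls do not depend on the ambient function space.
\<close>

instantiation "fun" :: (type, real_vector) real_vector
begin

definition scaleR_fun :: "real \<Rightarrow> ('a \<Rightarrow> 'b) \<Rightarrow> 'a \<Rightarrow> 'b" where
  "scaleR_fun r f = (\<lambda>x. r *\<^sub>R f x)"

instance
  by standard (simp_all add: scaleR_fun_def fun_eq_iff scaleR_add_right scaleR_add_left)

end

definition simplicial_complex :: "'i set \<Rightarrow> 'i set set \<Rightarrow> bool" where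
  "simplicial_complex I \<Delta> \<longleftrightarrow>
     finite I \<and> \<Delta> \<subseteq> Pow I \<and> (\<forall>\<sigma>\<in>\<Delta>. \<forall>\<tau>. \<tau> \<subseteq> \<sigma> \<longrightarrow> \<tau> \<in> \<Delta>)"

definition link :: "'i set set \<Rightarrow> 'i set \<Rightarrow> 'i set set" where
  "link \<Delta> \<sigma> = {\<tau> \<in> \<Delta>. \<tau> \<union> \<sigma> \<in> \<Delta> \<and> \<tau> \<inter> \<sigma> = {}}"

definition convex_open_family :: "nat \<Rightarrow> 'i set \<Rightarrow> ('i \<Rightarrow> (nat \<Rightarrow> real) set) \<Rightarrow> bool" where
  "convex_open_family d I U \<longleftrightarrow> (\<forall>i\<in>I. convex (U i) \<and> openin (Euclidean_space d) (U i))"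

definition region :: "'i set \<Rightarrow> ('i \<Rightarrow> (nat \<Rightarrow> real) set) \<Rightarrow> 'i set \<Rightarrow> (nat \<Rightarrow> real) set" where
  "region I U \<sigma> = (if \<sigma> = {} then convex hull (\<Union>i\<in>I. U i) else (\<Inter>i\<in>\<sigma>. U i))"

definition nerve :: "'i set \<Rightarrow> ('i \<Rightarrow> (nat \<Rightarrow> real) set) \<Rightarrow> 'i set set" where
  "nerve I U = {\<sigma>. \<sigma> \<subseteq> I \<and> region I U \<sigma> \<noteq> {}}"

definition convex_union_representable_in :: "nat \<Rightarrow> 'i set \<Rightarrow> 'i set set \<Rightarrow> bool" where
  "convex_union_representable_in d I \<Delta> \<longleftrightarrow>
     (\<exists>U. convex_open_family d I U \<and> convex (\<Union>i\<in>I. U i) \<and> \<Delta> = nerve I U)"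

definition convex_union_representable :: "'i set \<Rightarrow> 'i set set \<Rightarrow> bool" where
  "convex_union_representable I \<Delta> \<longleftrightarrow> (\<exists>d. convex_union_representable_in d I \<Delta>)"

definition neural_code :: "nat \<Rightarrow> nat set set \<Rightarrow> bool" where
  "neural_code n C \<longleftrightarrow> C \<subseteq> Pow {1..n}"

definition code_of :: "nat \<Rightarrow> (nat \<Rightarrow> (nat \<Rightarrow> real) set) \<Rightarrow> nat set set" where
  "code_of n U =
     {\<sigma>. \<sigma> \<subseteq> {1..n} \<and> region {1..n} U \<sigma> - (\<Union>j\<in>{1..n} - \<sigma>. U j) \<noteq> {}}"

definition convex_realization ::
    "nat \<Rightarrow> nat \<Rightarrow> nat set set \<Rightarrow> (nat \<Rightarrow> (nat \<Rightarrow> real) set) \<Rightarrow> bool" where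
  "convex_realization d n C U \<longleftrightarrow> convex_open_family d {1..n} U \<and> C = code_of n U"

definition convex_code :: "nat \<Rightarrow> nat set set \<Rightarrow> bool" where
  "convex_code n C \<longleftrightarrow> (\<exists>d U. convex_realization d n C U)"

definition code_complex :: "nat \<Rightarrow> nat set set \<Rightarrow> nat set set" where
  "code_complex n C = simplicial_complex {1..n} hull C"

text \<open>
  Links of \<open>code_complex n C\<close> are regarded as complexes on the whole ground set \<open>{1..n}\<close>; elements of
  the ground set that are not vertices (such as those of \<open>\<sigma>\<close>) correspond to empty members of a
  representing family.
\<close>

definition nerve_obstruction :: "nat \<Rightarrow> nat set set \<Rightarrow> nat set \<Rightarrow> bool" where
  "nerve_obstruction n C \<sigma> \<longleftrightarrow>
     \<sigma> \<in> code_complex n C - C \<and>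
     \<not> convex_union_representable {1..n} (link (code_complex n C) \<sigma>)"

definition locally_perfect :: "nat \<Rightarrow> nat set set \<Rightarrow> bool" where
  "locally_perfect n C \<longleftrightarrow> (\<nexists>\<sigma>. nerve_obstruction n C \<sigma>)"

end

theory Submission
  imports Defs
begin

text \<open>
  Let \<open>U\<close> be a family of convex open sets with code \<open>C\<close>. Reading off at each point the set of all
  indices whose member contains it shows that \<open>\<Delta>(C)\<close> is the nerve of \<open>U\<close>
  (\<open>code_complex_code_of\<close>). Intersecting the members of \<open>U\<close> with a region \<open>U\<^sub>\<sigma>\<close> turns
  \<open>U\<^sub>\<tau>\<close>, for nonempty \<open>\<tau>\<close>, into \<open>U\<^bsub>\<tau> \<union> \<sigma>\<^esub>\<close>. The nonempty faces of the new nerve that avoid \<open>\<sigma>\<close> are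
  therefore those of the link of \<open>\<sigma>\<close>, and emptying the members indexed by \<open>\<sigma>\<close> removes all others.

  If \<open>\<sigma> \<notin> C\<close>, then the members outside \<open>\<sigma>\<close> cover \<open>U\<^sub>\<sigma>\<close>. Hence the union of the localised family
  is exactly \<open>U\<^sub>\<sigma>\<close>, a convex set, and the localised family represents the link
  (\<open>link_nerve_representable\<close>). It lives in the same space as \<open>U\<close>, which gives the bound on the
  dimension.

  The convention \<open>U\<^sub>\<emptyset> = conv (\<Union>\<^sub>i U\<^sub>i)\<close> lets \<open>\<sigma> = \<emptyset>\<close> follow the same pattern, except that the
  openness of \<open>U\<^sub>\<sigma>\<close> has a different reason: \<open>U\<^sub>\<emptyset>\<close> is a hull rather than a finite intersection,
  but the covering property turns it into a union of open sets.
\<close>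

section \<open>Regions and the complex of a code\<close>

lemma region_subset_hull:
  assumes "\<sigma> \<subseteq> I"
  shows "region I U \<sigma> \<subseteq> convex hull (\<Union>i\<in>I. U i)"
proof (cases "\<sigma> = {}")
  case False
  then obtain i where i: "i \<in> \<sigma>" by blast
  then have "region I U \<sigma> \<subseteq> U i"
    by (auto simp: region_def)
  also have "U i \<subseteq> (\<Union>i\<in>I. U i)"
    using i assms by blast
  also have "\<dots> \<subseteq> convex hull (\<Union>i\<in>I. U i)"
    by (rule hull_subset)
  finally show ?thesis .
qed (simp add: region_def)

lemma region_antimono:
  assumes "\<tau> \<subseteq> \<sigma>" and "\<sigma> \<subseteq> I"
  shows "region I U \<sigma> \<subseteq> region I U \<tau>"
proof (cases "\<tau> = {}")
  case True
  then show ?thesis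
    using region_subset_hull[OF assms(2)] by (simp add: region_def)
next
  case False
  then show ?thesis
    using assms by (auto simp: region_def)
qed

text \<open>
  For \<open>\<sigma> = {}\<close> this still holds because the members of the family lie in the
  convex hull of their union.
\<close>

lemma region_Un_eq_INT:
  assumes "\<tau> \<noteq> {}" and "\<tau> \<subseteq> I"
  shows "region I U (\<tau> \<union> \<sigma>) = (\<Inter>i\<in>\<tau>. U i \<inter> region I U \<sigma>)"
proof (cases "\<sigma> = {}")
  case True
  have "U i \<subseteq> convex hull (\<Union>i\<in>I. U i)" if "i \<in> \<tau>" for i
    using that assms(2) hull_subset[of "\<Union>i\<in>I. U i" convex] by blast
  then show ?thesis
    using True assms(1) by (auto simp: region_def)
next
  case False
  then show ?thesis
    using assms(1) by (auto simp: region_def)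
qed

lemma convex_region:
  assumes "convex_open_family d I U" and "\<sigma> \<subseteq> I"
  shows "convex (region I U \<sigma>)"
  using assms
  by (auto simp: region_def convex_open_family_def intro!: convex_INT convex_convex_hull)

lemma code_complex_eq_subfaces:
  assumes "neural_code n C"
  shows "code_complex n C = {\<tau>. \<exists>c\<in>C. \<tau> \<subseteq> c}"
  unfolding code_complex_def
proof (rule hull_unique)
  show "simplicial_complex {1..n} {\<tau>. \<exists>c\<in>C. \<tau> \<subseteq> c}"
    using assms unfolding simplicial_complex_def neural_code_def by blast
  show "{\<tau>. \<exists>c\<in>C. \<tau> \<subseteq> c} \<subseteq> \<Delta>" if "C \<subseteq> \<Delta>" and "simplicial_complex {1..n} \<Delta>" for \<Delta>
    using that unfolding simplicial_complex_def by blast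
qed blast

text \<open>
  A face \<open>\<tau>\<close> of the nerve extends to a codeword, namely the set of all indices whose member contains
  a chosen point of \<open>U\<^sub>\<tau>\<close>. This set can be empty only when the point lies in the hull but outside the
  union, and then the empty set is a codeword by the convention for \<open>U\<^sub>\<emptyset>\<close>.
\<close>

lemma code_complex_code_of:
  "code_complex n (code_of n U) = nerve {1..n} U"
proof -
  let ?I = "{1..n}"
  have "neural_code n (code_of n U)"
    by (auto simp: neural_code_def code_of_def)
  then have subfaces: "code_complex n (code_of n U) = {\<tau>. \<exists>c\<in>code_of n U. \<tau> \<subseteq> c}"
    by (rule code_complex_eq_subfaces)
  have "\<tau> \<in> nerve ?I U" if "c \<in> code_of n U" and "\<tau> \<subseteq> c" for c \<tau>
  proof -
    have "c \<subseteq> ?I" and "region ?I U c \<noteq> {}"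
      using that(1) by (auto simp: code_of_def)
    then show ?thesis
      using region_antimono[OF that(2), of ?I U] that(2) unfolding nerve_def by blast
  qed
  moreover have "\<exists>c\<in>code_of n U. \<tau> \<subseteq> c" if "\<tau> \<in> nerve ?I U" for \<tau>
  proof -
    have \<tau>: "\<tau> \<subseteq> ?I" and "region ?I U \<tau> \<noteq> {}"
      using that by (auto simp: nerve_def)
    then obtain x where x: "x \<in> region ?I U \<tau>"
      by blast
    let ?c = "{j \<in> ?I. x \<in> U j}"
    have "x \<in> region ?I U ?c - (\<Union>j\<in>?I - ?c. U j)"
      using x region_subset_hull[OF \<tau>, of U] by (auto simp: region_def)
    then have "?c \<in> code_of n U"
      unfolding code_of_def by blast
    moreover have "\<tau> \<subseteq> ?c"
      using x \<tau> by (auto simp: region_def split: if_splits)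
    ultimately show ?thesis by blast
  qed
  ultimately show ?thesis
    unfolding subfaces by blast
qed

section \<open>Localising a family at a covered region\<close>

text \<open>The members indexed by \<open>\<sigma>\<close> are emptied since a link contains only faces disjoint from \<open>\<sigma>\<close>.\<close>

definition localise :: "'i set \<Rightarrow> ('i \<Rightarrow> (nat \<Rightarrow> real) set) \<Rightarrow> 'i set \<Rightarrow> 'i \<Rightarrow> (nat \<Rightarrow> real) set" where
  "localise I U \<sigma> i = (if i \<in> \<sigma> then {} else U i \<inter> region I U \<sigma>)"

lemma Union_localise:
  assumes "region I U \<sigma> \<subseteq> (\<Union>j\<in>I - \<sigma>. U j)"
  shows "(\<Union>i\<in>I. localise I U \<sigma> i) = region I U \<sigma>"
  using assms by (auto simp: localise_def)

text \<open>
  For nonempty \<open>\<sigma>\<close> openness is preserved by finite intersection. For empty \<open>\<sigma>\<close> the hypothesis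
  says that the union of the family fills its own hull, which is therefore open.
\<close>

lemma openin_covered_region:
  assumes "finite I" and U: "convex_open_family d I U" and "\<sigma> \<subseteq> I"
    and cover: "region I U \<sigma> \<subseteq> (\<Union>j\<in>I - \<sigma>. U j)"
  shows "openin (Euclidean_space d) (region I U \<sigma>)"
proof (cases "\<sigma> = {}")
  case True
  then have "region I U \<sigma> = (\<Union>i\<in>I. U i)"
    using cover hull_subset[of "\<Union>i\<in>I. U i" convex] by (simp add: region_def subset_antisym)
  then show ?thesis
    using U by (auto simp: convex_open_family_def)
next
  case False
  have "finite \<sigma>"
    using assms(1,3) finite_subset by blast
  then show ?thesis
    using False U assms(3)
    by (auto simp: region_def convex_open_family_def intro!: openin_INT2)
qed

lemma convex_open_family_localise:
  assumes "finite I" and U: "convex_open_family d I U" and "\<sigma> \<subseteq> I"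
    and "region I U \<sigma> \<subseteq> (\<Union>j\<in>I - \<sigma>. U j)"
  shows "convex_open_family d I (localise I U \<sigma>)"
  using U convex_region[OF U assms(3)] openin_covered_region[OF assms]
  by (auto simp: convex_open_family_def localise_def intro: convex_Int)

text \<open>
  The covering hypothesis matters for the empty face: it makes the union of the localised family
  convex, so that its hull is \<open>U\<^sub>\<sigma>\<close> and not merely a convex subset of it.
\<close>

lemma region_localise:
  assumes U: "convex_open_family d I U" and "\<sigma> \<subseteq> I"
    and cover: "region I U \<sigma> \<subseteq> (\<Union>j\<in>I - \<sigma>. U j)"
    and "\<tau> \<subseteq> I"
  shows "region I (localise I U \<sigma>) \<tau> = (if \<tau> \<inter> \<sigma> = {} then region I U (\<tau> \<union> \<sigma>) else {})"
proof (cases "\<tau> = {}")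
  case True
  have "convex hull (\<Union>i\<in>I. localise I U \<sigma> i) = region I U \<sigma>"
    unfolding Union_localise[OF cover] using convex_region[OF U assms(2)] by (rule hull_same)
  then have "region I (localise I U \<sigma>) {} = region I U \<sigma>"
    by (simp add: region_def)
  then show ?thesis
    using True by simp
next
  case False
  then have "region I (localise I U \<sigma>) \<tau> = (\<Inter>i\<in>\<tau>. localise I U \<sigma> i)"
    by (simp add: region_def)
  also have "\<dots> = (if \<tau> \<inter> \<sigma> = {} then (\<Inter>i\<in>\<tau>. U i \<inter> region I U \<sigma>) else {})"
    by (auto simp: localise_def split: if_splits)
  also have "\<dots> = (if \<tau> \<inter> \<sigma> = {} then region I U (\<tau> \<union> \<sigma>) else {})"
    by (simp only: region_Un_eq_INT[OF False assms(4)])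
  finally show ?thesis .
qed

lemma nerve_localise:
  assumes "convex_open_family d I U" and "\<sigma> \<subseteq> I"
    and "region I U \<sigma> \<subseteq> (\<Union>j\<in>I - \<sigma>. U j)"
  shows "nerve I (localise I U \<sigma>) = link (nerve I U) \<sigma>"
proof -
  have "\<tau> \<in> nerve I U" if "\<tau> \<union> \<sigma> \<in> nerve I U" for \<tau>
    using that region_antimono[of \<tau> "\<tau> \<union> \<sigma>" I U] by (auto simp: nerve_def)
  then have "link (nerve I U) \<sigma> = {\<tau>. \<tau> \<union> \<sigma> \<in> nerve I U \<and> \<tau> \<inter> \<sigma> = {}}"
    unfolding link_def by blast
  also have "\<dots> = nerve I (localise I U \<sigma>)"
    using assms(2) region_localise[OF assms] by (auto simp: nerve_def split: if_splits)
  finally show ?thesis by simp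
qed

theorem link_nerve_representable:
  assumes "finite I" and "convex_open_family d I U" and "\<sigma> \<subseteq> I"
    and "region I U \<sigma> \<subseteq> (\<Union>j\<in>I - \<sigma>. U j)"
  shows "convex_union_representable_in d I (link (nerve I U) \<sigma>)"
  unfolding convex_union_representable_in_def
proof (intro exI conjI)
  show "convex_open_family d I (localise I U \<sigma>)"
    using assms by (rule convex_open_family_localise)
  show "convex (\<Union>i\<in>I. localise I U \<sigma> i)"
    unfolding Union_localise[OF assms(4)] using assms(2,3) by (rule convex_region)
  show "link (nerve I U) \<sigma> = nerve I (localise I U \<sigma>)"
    using nerve_localise[OF assms(2-4)] by simp
qed

section \<open>Convex codes are locally perfect\<close>

lemma convex_realization_link_representable:
  assumes real: "convex_realization d n C U" and \<sigma>: "\<sigma> \<in> code_complex n C - C"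
  shows "convex_union_representable_in d {1..n} (link (code_complex n C) \<sigma>)"
proof -
  have U: "convex_open_family d {1..n} U" and C: "C = code_of n U"
    using real by (auto simp: convex_realization_def)
  have complex: "code_complex n C = nerve {1..n} U"
    unfolding C by (rule code_complex_code_of)
  have sub: "\<sigma> \<subseteq> {1..n}"
    using \<sigma> unfolding complex by (auto simp: nerve_def)
  moreover have "region {1..n} U \<sigma> \<subseteq> (\<Union>j\<in>{1..n} - \<sigma>. U j)"
    using \<sigma> sub unfolding C code_of_def by blast
  ultimately show ?thesis
    unfolding complex using link_nerve_representable[OF finite_atLeastAtMost U] by blast
qed

theorem proposition9p4:
  fixes n :: nat and C :: "nat set set"
  assumes "neural_code n C"
  shows "(convex_code n C \<longrightarrow> locally_perfect n C) \<and>
    (\<forall>d. (\<exists>U. convex_realization d n C U) \<longrightarrow>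
      (\<forall>\<sigma> \<in> code_complex n C - C.
         convex_union_representable_in d {1..n} (link (code_complex n C) \<sigma>)))"
  using convex_realization_link_representable
  unfolding convex_code_def locally_perfect_def nerve_obstruction_def convex_union_representable_def
  by blast

end
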